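(* Let $n\ge 10$ be even, and let $\mathbf{c}_1=\overline{0011}[n]$, $\mathbf{c}_2=101\cdot\overline{0}[n-3]$, $\mathbf{c}_3=\overline{0}[n-3]\cdot 100$, $\mathbf{c}_4=\overline{1100}[n]$, $\mathbf{c}_5=001\cdot\overline{0}[n-3]$, $\mathbf{c}_6=\overline{0}[n-3]\cdot 101$. (i) If $n\equiv 0\pmod 4$, then $w_3=2n-3$ and $W_3=\{\mathbf{c}_1,\mathbf{c}_2,\mathbf{c}_3,\mathbf{c}_4,\mathbf{c}_5,\mathbf{c}_6\}$. (ii) If $n\equiv 2\pmod 4$, then $w_3=2n-4$ and $W_3=\{\mathbf{c}_1,\mathbf{c}_3,\mathbf{c}_5\}$.
   Context: For $\mathbf{x}=(x_0,\ldots,x_{n-1})\in\mathbb{F}_2^n$, the derivative is $\partial\mathbf{x}=(x_0+x_1,\ldots,x_{n-2}+x_{n-1})\in\mathbb{F}_2^{n-1}$, with $\partial^0\mathbf{x}=\mathbf{x}$ and $\partial^i\mathbf{x}=\partial(\partial^{i-1}\mathbf{x})$. The Steinhaus triangle is $T(\mathbf{x})=(\mathbf{x},\partial\mathbf{x},\ldots,\partial^{n-1}\mathbf{x})$; $|\mathbf{y}|$ is the number of ones of a binary sequence and $|T(\mathbf{x})|=\sum_{i=0}^{n-1}|\partial^i\mathbf{x}|$. For fixed $n$, let $0=w_0<w_1<\cdots<w_m$ be the distinct values of $|T(\mathbf{x})|$ over $\mathbf{x}\in\mathbb{F}_2^n$, and $W_i=\{\mathbf{x}\in\mathbb{F}_2^n:|T(\mathbf{x})|=w_i\}$.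 Sequences are written as words; a dot denotes concatenation; $\overline{x_1\cdots x_p}[k]$ is the word of the first $k$ letters of the infinite periodic word $x_1\cdots x_px_1\cdots x_p\cdots$. *)

theory Defs
  imports "HOL-Library.Z2"
begin

text \<open>Type \<^typ>\<open>bit\<close> is the field with two elements: addition is addition modulo 2.
  Binary sequences are lists over this type.\<close>

definition binary_words :: "nat \<Rightarrow> bit list set" where
  "binary_words n = {x. length x = n}"

definition derivative :: "bit list \<Rightarrow> bit list" where
  "derivative x = map (\<lambda>i. x ! i + x ! (i + 1)) [0..<length x - 1]"

definition steinhaus_triangle :: "bit list \<Rightarrow> bit list list" where
  "steinhaus_triangle x = map (\<lambda>i. (derivative ^^ i) x) [0..<length x]"

definition ones :: "bit list \<Rightarrow> nat" where
  "ones y = count_list y 1"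

definition triangle_weight :: "bit list \<Rightarrow> nat" where
  "triangle_weight x = (\<Sum>y\<leftarrow>steinhaus_triangle x. ones y)"

definition triangle_weights :: "nat \<Rightarrow> nat set" where
  "triangle_weights n = triangle_weight ` binary_words n"

text \<open>The distinct values in increasing order, indexed from 0. The value is meaningful only for
  \<open>i < card (triangle_weights n)\<close>.\<close>

definition nth_weight :: "nat \<Rightarrow> nat \<Rightarrow> nat" where
  "nth_weight n i = sorted_list_of_set (triangle_weights n) ! i"

definition weight_class :: "nat \<Rightarrow> nat \<Rightarrow> bit list set" where
  "weight_class n i = {x \<in> binary_words n. triangle_weight x = nth_weight n i}"

definition periodic_prefix :: "'a list \<Rightarrow> nat \<Rightarrow> 'a list" where
  "periodic_prefix p k = map (\<lambda>i. p ! (i mod length p)) [0..<k]"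

end

theory Submission
  imports Defs
begin

text \<open>Call a word light if its triangle has weight at most \<open>2 * n - 3\<close>. For \<open>n \<ge> 16\<close> the triangle
  of a light word is supported on three consecutive lines parallel to and including one of its
  sides. If the top row has at least two ones, then deleting it gives a light word of length
  \<open>n - 1\<close>, so by induction \<open>\<partial>x\<close> belongs to one of three explicit families; in each of them, the rows
  (or the recursion for the weight) have period 4, and integrating once gives either a member of the
  same kind or a weight that grows at least like \<open>9 / 4 * n\<close> or is too large by a constant. If the
  top row is a single one, at distance at least 3 from both ends, then the top four rows contain
  \<open>1 + 2 + 2 + 4\<close> ones, so \<open>\<partial>\<^sup>4x\<close> is light, but it has two ones at distance 4. The finitely many small
  lengths are settled by the same deletion argument, which produces the short list of all light
  words of length \<open>n\<close> from the list for \<open>n - 1\<close>. The weights of the three families are explicit, and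
  the theorem is read off from them.\<close>

subsection \<open>Derivatives and weights\<close>

lemma length_derivative [simp]: "length (derivative x) = length x - 1"
  by (simp add: derivative_def)

lemma nth_derivative: "i + 1 < length x \<Longrightarrow> derivative x ! i = x ! i + x ! (i + 1)"
  \<comment> \<open>The simp rule \<open>add_bit_eq_xor\<close> would turn sums of bits into
    \<open>XOR\<close>, out of reach of rules stated with \<open>+\<close>; hence its removal here
    and below.\<close>
  by (simp add: derivative_def less_diff_conv del: add_bit_eq_xor)

lemma derivative_code [code]:
  "derivative [] = []"
  "derivative [a] = []"
  "derivative (a # b # x) = (a + b) # derivative (b # x)"
proof -
  have "[0..<Suc (length x)] = 0 # map Suc [0..<length x]"
    by (simp add: map_Suc_upt upt_conv_Cons del: upt_Suc)
  then show "derivative (a # b # x) = (a + b) # derivative (b # x)"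
    by (simp add: derivative_def comp_def del: upt_Suc add_bit_eq_xor)
qed (simp_all add: derivative_def)

lemma ones_code [code]:
  "ones [] = 0"
  "ones (0 # x) = ones x"
  "ones (1 # x) = Suc (ones x)"
  by (simp_all add: ones_def)

lemma ones_append [simp]: "ones (x @ y) = ones x + ones y"
  by (simp add: ones_def)

lemma triangle_weight_code [code]:
  "triangle_weight [] = 0"
  "triangle_weight (a # x) = ones (a # x) + triangle_weight (derivative (a # x))"
proof -
  have "[0..<Suc (length x)] = 0 # map Suc [0..<length x]"
    by (simp add: map_Suc_upt upt_conv_Cons del: upt_Suc)
  then show "triangle_weight (a # x) = ones (a # x) + triangle_weight (derivative (a # x))"
    by (simp add: triangle_weight_def steinhaus_triangle_def comp_def funpow_swap1 del: upt_Suc)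
qed (simp add: triangle_weight_def steinhaus_triangle_def)

lemma triangle_weight_rec: "triangle_weight x = ones x + triangle_weight (derivative x)"
  by (cases x) (simp_all add: triangle_weight_code derivative_code ones_code)

lemma bit_add_code [code]: "0 + b = (b::bit)" "1 + 0 = (1::bit)" "1 + 1 = (0::bit)"
  by (simp_all del: add_bit_eq_xor)

subsection \<open>Enumeration of the light words\<close>

text \<open>The antiderivative with first letter \<open>d\<close>. The two values of
  \<open>d\<close> give all antiderivatives, which are complementary.\<close>

fun integrate :: "bit \<Rightarrow> bit list \<Rightarrow> bit list" where
  "integrate d [] = [d]"
| "integrate d (a # y) = d # integrate (d + a) y"

lemma bit_add_cancel: "a + (a + b) = (b::bit)"
  by (cases a; cases b) simp_all

lemma integrate_derivative: "integrate a (derivative (a # x)) = a # x"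
  by (induction x arbitrary: a) (simp_all add: derivative_code bit_add_cancel del: add_bit_eq_xor)

text \<open>Words with at most one 1, the exceptions to the deletion argument: the bound
  \<open>2 * length x\<close> drops by 2 with each row, so a deleted row needs two ones.\<close>

fun sparse_words :: "nat \<Rightarrow> bit list list" where
  "sparse_words 0 = [[]]"
| "sparse_words (Suc n) = (1 # replicate n 0) # map ((#) 0) (sparse_words n)"

lemma ones_eq_0_iff: "ones x = 0 \<longleftrightarrow> x = replicate (length x) 0"
proof (induction x)
  case (Cons a x)
  then show ?case by (cases a) (simp_all add: ones_code)
qed (simp add: ones_code)

lemma sparse_wordsI: "ones x \<le> 1 \<Longrightarrow> x \<in> set (sparse_words (length x))"
proof (induction x)
  case (Cons a x)
  then show ?case by (cases a) (auto simp: ones_code ones_eq_0_iff)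
qed simp

text \<open>Removing a top row with at least two ones preserves \<open>triangle_weight x + 3 \<le> 2 * length x\<close>, so
  only the sparse words have to be added by hand.\<close>

fun light_words :: "nat \<Rightarrow> bit list list" where
  "light_words 0 = []"
| "light_words (Suc n) = filter (\<lambda>x. triangle_weight x + 3 \<le> 2 * Suc n)
     (sparse_words (Suc n) @
      filter (\<lambda>x. 2 \<le> ones x) (concat (map (\<lambda>y. [integrate 0 y, integrate 1 y]) (light_words n))))"

lemma light_wordsI: "triangle_weight x + 3 \<le> 2 * length x \<Longrightarrow> x \<in> set (light_words (length x))"
proof (induction "length x" arbitrary: x)
  case (Suc n)
  from Suc(2) obtain a y where x: "x = a # y" by (cases x) auto
  show ?case
  proof (cases "ones x \<le> 1")
    case True
    from sparse_wordsI[OF this] Suc.prems show ?thesis by (simp flip: Suc(2) del: sparse_words.simps)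
  next
    case False
    then have "triangle_weight (derivative x) + 3 \<le> 2 * length (derivative x)"
      using Suc.prems Suc(2) triangle_weight_rec[of x] by auto
    then have "derivative x \<in> set (light_words n)"
      using Suc(1)[of "derivative x"] by (simp flip: Suc(2))
    moreover have "x = integrate a (derivative x)" by (simp add: x integrate_derivative)
    then have "x = integrate 0 (derivative x) \<or> x = integrate 1 (derivative x)"
      by (cases a) auto
    ultimately have "x \<in> set (concat (map (\<lambda>y. [integrate 0 y, integrate 1 y]) (light_words n)))"
      by auto
    then show ?thesis using False Suc.prems by (simp flip: Suc(2) del: sparse_words.simps)
  qed
qed (simp add: triangle_weight_def)

text \<open>The three families consist of the words whose triangle is supported on the three lines next to
  the right, the left, and the top side; for the top side this means \<open>\<partial>\<^sup>3x = 0\<close>.\<close>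

definition thin :: "bit list \<Rightarrow> bool" where
  "thin x \<longleftrightarrow> (\<exists>a b c. x = replicate (length x - 3) 0 @ [a, b, c]
     \<or> x = [a, b, c] @ replicate (length x - 3) 0
     \<or> x = periodic_prefix [a, b, c, a + b + c] (length x))"

lemma ex_bit: "(\<exists>a::bit. P a) \<longleftrightarrow> P 0 \<or> P 1"
  by (metis bit_not_one_iff)

text \<open>The quantifiers over bits become a finite list, which makes \<open>thin\<close>
  executable.\<close>

lemma thin_code [code]:
  "thin x \<longleftrightarrow> (\<exists>(a, b, c) \<in> set (List.product [0, 1] (List.product [0, 1] [0, 1])).
     x = replicate (length x - 3) 0 @ [a, b, c]
     \<or> x = [a, b, c] @ replicate (length x - 3) 0
     \<or> x = periodic_prefix [a, b, c, a + b + c] (length x))"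
  unfolding thin_def ex_bit by (simp add: disj_assoc)

subsection \<open>Weights of the three families\<close>

lemma derivative_rev: "derivative (rev x) = rev (derivative x)"
proof (rule nth_equalityI)
  fix i assume "i < length (derivative (rev x))"
  then have "length x - Suc i = Suc (length x - Suc (Suc i))"
    "length x - Suc (Suc i) < length x - 1" "i < length x - 1" "Suc i < length x"
    by simp_all
  then show "derivative (rev x) ! i = rev (derivative x) ! i"
    by (simp add: derivative_def rev_nth add.commute del: add_bit_eq_xor)
qed simp

text \<open>Reflection reverses every row, so weights in the left family follow from those in the
  right one.\<close>

lemma triangle_weight_rev: "triangle_weight (rev x) = triangle_weight x"
proof (induction "length x" arbitrary: x)
  case (Suc n)
  have "triangle_weight (rev (derivative x)) = triangle_weight (derivative x)"
    by (rule Suc(1)) (simp flip: Suc(2))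
  then show ?case
    by (simp add: triangle_weight_rec[of x] triangle_weight_rec[of "rev x"] derivative_rev ones_def)
qed simp

lemma triangle_weight_replicate_0 [simp]: "triangle_weight (replicate n 0) = 0"
proof (induction n)
  case (Suc n)
  have "derivative (replicate (Suc n) 0) = replicate n 0"
    by (induction n) (simp_all add: derivative_code)
  then show ?case using Suc by (subst triangle_weight_rec) (simp add: ones_def)
qed (simp add: triangle_weight_code)

lemma ones_replicate [simp]: "ones (replicate n 0) = 0" "ones (replicate n 1) = n"
  by (induction n) (simp_all add: ones_code)

section \<open>The family along the right side\<close>

lemma derivative_replicate_append:
  "derivative (replicate (Suc n) a @ x) = replicate n 0 @ derivative (a # x)"
  by (induction n) (cases a; simp add: derivative_code)+

lemma triangle_weight_tail_Suc:
  "triangle_weight (replicate (Suc k) 0 @ [a, b, c]) =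
   ones [a, b, c] + triangle_weight (replicate k 0 @ [a, a + b, b + c])"
  by (subst triangle_weight_rec)
    (simp add: derivative_replicate_append derivative_code del: replicate_Suc add_bit_eq_xor)

text \<open>The last three letters undergo the linear map sending \<open>(a, b, c)\<close> to
  \<open>(a, a + b, b + c)\<close>. It is the identity plus a map with cube zero, so its fourth
  power is the identity over the two-element field, and the rows have period 4.\<close>

lemma triangle_weight_tail:
  "triangle_weight (replicate (4 * q + s) 0 @ [a, b, c]) =
   q * (ones [a, b, c] + ones [a, a + b, b + c] + ones [a, b, a + c] + ones [a, a + b, a + b + c])
   + triangle_weight (replicate s 0 @ [a, b, c])"
proof (induction q)
  case (Suc q)
  have "4 * Suc q + s = Suc (Suc (Suc (Suc (4 * q + s))))" by simp
  moreover have "triangle_weight (replicate (Suc (Suc (Suc (Suc k)))) 0 @ [a, b, c]) =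
      ones [a, b, c] + ones [a, a + b, b + c] + ones [a, b, a + c] + ones [a, a + b, a + b + c]
      + triangle_weight (replicate k 0 @ [a, b, c])" for k
    by (cases a; cases b; cases c)
      (simp_all add: triangle_weight_tail_Suc del: replicate_Suc)
  ultimately show ?case using Suc
    by (simp only: mult_Suc add.assoc)
qed simp

lemma triangle_weight_tail_small:
  "triangle_weight [a, b, c] = ones [a, b, c] + ones [a + b, b + c] + ones [a + c]"
  "triangle_weight [0, a, b, c] =
    ones [a, b, c] + ones [a, a + b, b + c] + ones [b, a + c] + ones [a + b + c]"
  "triangle_weight (replicate 2 0 @ [a, b, c]) =
    ones [a, b, c] + ones [a, a + b, b + c] + ones [a, b, a + c] + ones [a + b, a + b + c] + ones [c]"
  "triangle_weight (replicate 3 0 @ [a, b, c]) =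
    ones [a, b, c] + ones [a, a + b, b + c] + ones [a, b, a + c] + ones [a, a + b, a + b + c]
    + ones [b, c] + ones [b + c]"
  by (cases a; cases b; cases c; simp add: numeral_eq_Suc triangle_weight_code derivative_code ones_code)+

section \<open>The family along the top side\<close>

lemma length_periodic_prefix [simp]: "length (periodic_prefix p n) = n"
  by (simp add: periodic_prefix_def)

lemma ones_periodic_prefix:
  assumes "length p = 4"
  shows "ones (periodic_prefix p (4 * q + s)) = q * ones p + ones (periodic_prefix p s)"
proof (induction q)
  case (Suc q)
  have "periodic_prefix p (4 + n) = p @ periodic_prefix p n" for n
    by (rule nth_equalityI) (auto simp: periodic_prefix_def nth_append assms le_mod_geq)
  from this[of "4 * q + s"] show ?case using Suc by (simp add: add.assoc)
qed simp

lemma periodic_prefix_small: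
  "periodic_prefix [a, b, c, d] 0 = []"
  "periodic_prefix [a, b, c, d] (Suc 0) = [a]"
  "periodic_prefix [a, b, c, d] 2 = [a, b]"
  "periodic_prefix [a, b, c, d] 3 = [a, b, c]"
  "periodic_prefix [a, b, c, d] 4 = [a, b, c, d]"
  "periodic_prefix [a, b, c, d] 5 = [a, b, c, d, a]"
  "periodic_prefix [a, b, c, d] 6 = [a, b, c, d, a, b]"
  by (simp_all add: periodic_prefix_def upt_rec)

text \<open>The simplifier turns small summands into \<open>Suc\<close>, so some cases are stated in both forms.\<close>

lemma ones_periodic_prefix_small:
  "ones (periodic_prefix [a, b, c, d] (4 * q)) = q * ones [a, b, c, d]"
  "ones (periodic_prefix [a, b, c, d] (Suc (4 * q))) = q * ones [a, b, c, d] + ones [a]"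
  "ones (periodic_prefix [a, b, c, d] (Suc (Suc (4 * q)))) = q * ones [a, b, c, d] + ones [a, b]"
  "ones (periodic_prefix [a, b, c, d] (Suc (Suc (Suc (4 * q))))) = q * ones [a, b, c, d] + ones [a, b, c]"
  "ones (periodic_prefix [a, b, c, d] (4 * q + 3)) = q * ones [a, b, c, d] + ones [a, b, c]"
  "ones (periodic_prefix [a, b, c, d] (Suc (Suc (Suc (Suc (4 * q)))))) = q * ones [a, b, c, d] + ones [a, b, c, d]"
  "ones (periodic_prefix [a, b, c, d] (4 * q + 4)) = q * ones [a, b, c, d] + ones [a, b, c, d]"
  "ones (periodic_prefix [a, b, c, d] (4 * q + 5)) = q * ones [a, b, c, d] + ones [a, b, c, d, a]"
  "ones (periodic_prefix [a, b, c, d] (4 * q + 6)) = q * ones [a, b, c, d] + ones [a, b, c, d, a, b]"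
proof -
  have *: "ones (periodic_prefix [a, b, c, d] (4 * q + s)) =
      q * ones [a, b, c, d] + ones (periodic_prefix [a, b, c, d] s)" for s
    by (simp add: ones_periodic_prefix)
  show "ones (periodic_prefix [a, b, c, d] (4 * q)) = q * ones [a, b, c, d]"
    "ones (periodic_prefix [a, b, c, d] (Suc (4 * q))) = q * ones [a, b, c, d] + ones [a]"
    "ones (periodic_prefix [a, b, c, d] (Suc (Suc (4 * q)))) = q * ones [a, b, c, d] + ones [a, b]"
    "ones (periodic_prefix [a, b, c, d] (Suc (Suc (Suc (4 * q))))) = q * ones [a, b, c, d] + ones [a, b, c]"
    "ones (periodic_prefix [a, b, c, d] (4 * q + 3)) = q * ones [a, b, c, d] + ones [a, b, c]"
    "ones (periodic_prefix [a, b, c, d] (Suc (Suc (Suc (Suc (4 * q)))))) = q * ones [a, b, c, d] + ones [a, b, c, d]"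
    "ones (periodic_prefix [a, b, c, d] (4 * q + 4)) = q * ones [a, b, c, d] + ones [a, b, c, d]"
    "ones (periodic_prefix [a, b, c, d] (4 * q + 5)) = q * ones [a, b, c, d] + ones [a, b, c, d, a]"
    "ones (periodic_prefix [a, b, c, d] (4 * q + 6)) = q * ones [a, b, c, d] + ones [a, b, c, d, a, b]"
    using *[of 0] *[of 1] *[of 2] *[of 3] *[of 4] *[of 5] *[of 6]
    unfolding periodic_prefix_small One_nat_def
    by (simp_all add: numeral_eq_Suc ones_code)
qed

lemma derivative_periodic_prefix:
  "derivative (periodic_prefix [a, b, c, d] n) =
   periodic_prefix [a + b, b + c, c + d, d + a] (n - 1)"
proof (rule nth_equalityI)
  fix i assume "i < length (derivative (periodic_prefix [a, b, c, d] n))"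
  then have "i + 1 < n" by simp
  moreover have "i mod 4 = 0 \<and> Suc i mod 4 = 1 \<or> i mod 4 = 1 \<and> Suc i mod 4 = 2
      \<or> i mod 4 = 2 \<and> Suc i mod 4 = 3 \<or> i mod 4 = 3 \<and> Suc i mod 4 = 0"
    by presburger
  ultimately show "derivative (periodic_prefix [a, b, c, d] n) ! i =
      periodic_prefix [a + b, b + c, c + d, d + a] (n - 1) ! i"
    by (auto simp: periodic_prefix_def derivative_def simp del: add_bit_eq_xor)
qed simp

lemma periodic_prefix_singleton: "periodic_prefix [a] n = replicate n a"
  by (simp add: periodic_prefix_def map_replicate_const)

text \<open>Each letter of the third derivative is a sum of four consecutive letters, as 1, 3, 3, 1
  are odd. Here all these sums vanish, so only the top three rows count.\<close>

lemma triangle_weight_periodic: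
  "triangle_weight (periodic_prefix [a, b, c, a + b + c] n) =
   ones (periodic_prefix [a, b, c, a + b + c] n)
   + ones (periodic_prefix [a + b, b + c, a + b, b + c] (n - 1))
   + ones (periodic_prefix [a + c, a + c, a + c, a + c] (n - 2))"
proof -
  have zero: "periodic_prefix [0, 0, 0, 0] m = replicate m (0::bit)" for m
    by (rule nth_equalityI) (simp_all add: periodic_prefix_def nth_Cons')
  have eqs: "c + (a + b + c) = a + b" "a + b + c + a = b + c" "a + b + (b + c) = a + c"
    "b + c + (a + b) = a + c" "x + x = 0" for x :: bit
    by (cases a; cases b; cases c; simp)+
  show ?thesis
    by (subst triangle_weight_rec, subst derivative_periodic_prefix,
        subst triangle_weight_rec, subst derivative_periodic_prefix,
        subst triangle_weight_rec, subst derivative_periodic_prefix)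
      (simp add: eqs zero numeral_2_eq_2 del: add_bit_eq_xor)
qed

subsection \<open>Integrating a thin word\<close>

lemma integrate_replicate_append: "integrate d (replicate k 0 @ x) = replicate k d @ integrate d x"
  by (induction k) (simp_all del: add_bit_eq_xor)

lemma integrate_hd_derivative: "x \<noteq> [] \<Longrightarrow> x = integrate (hd x) (derivative x)"
  by (cases x) (simp_all add: integrate_derivative)

lemma nat_div4E:
  fixes k :: nat
  obtains q s where "k = 4 * q + s" "s = 0 \<or> s = 1 \<or> s = 2 \<or> s = 3"
proof -
  have "k = 4 * (k div 4) + k mod 4"
    "k mod 4 = 0 \<or> k mod 4 = 1 \<or> k mod 4 = 2 \<or> k mod 4 = 3" by presburger+
  then show thesis by (rule that)
qed

lemma thin_tail: "thin (replicate k 0 @ [a, b, c])"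
  unfolding thin_def by auto

lemma thin_head: "thin ([a, b, c] @ replicate k 0)"
  unfolding thin_def by auto

lemma thin_periodic: "thin (periodic_prefix [a, b, c, a + b + c] n)"
  unfolding thin_def length_periodic_prefix by blast

lemma thin_replicate: "thin (replicate n a)"
proof -
  have "periodic_prefix [a, a, a, a] n = replicate n a"
    by (rule nth_equalityI) (simp_all add: periodic_prefix_def nth_Cons')
  moreover have "a + a + a = a" by (cases a) simp_all
  ultimately show ?thesis by (metis thin_periodic)
qed

text \<open>A first letter 0 leads back to the family. A first letter 1 adds about \<open>k\<close>
  ones: for \<open>a = b = 0\<close>, \<open>c = 1\<close> the weight is \<open>2 * k + 6\<close>,
  one above the bound, and the other nonzero \<open>(a, b, c)\<close> give growth
  \<open>5 / 2 * k\<close> or \<open>3 * k\<close>. Only the word of ones survives.\<close>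

lemma eq_of_derivative_tail:
  assumes x: "length x = k + 4" and k: "12 \<le> k"
    and d: "derivative x = replicate k 0 @ [a, b, c]"
    and light: "triangle_weight x + 3 \<le> 2 * length x"
  shows "(\<exists>a b c. x = replicate (k + 1) 0 @ [a, b, c]) \<or> x = replicate (k + 4) 1"
proof -
  define e where "e = hd x"
  have x_eq: "x = replicate k e @ [e, e + a, e + a + b, e + a + b + c]"
    using integrate_hd_derivative[of x] x d unfolding e_def[symmetric]
    by (force simp: integrate_replicate_append simp del: add_bit_eq_xor)
  show ?thesis
  proof (cases "e = 0")
    case True
    then have "x = replicate (k + 1) 0 @ [a, a + b, a + b + c]"
      unfolding replicate_add by (subst x_eq) (simp del: add_bit_eq_xor)
    then show ?thesis by blast
  next
    case False
    then have 1: "e = 1" by simp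
    obtain q s where ks: "k = 4 * q + s" "s = 0 \<or> s = 1 \<or> s = 2 \<or> s = 3" by (rule nat_div4E)
    have "ones x = k + ones [1, 1 + a, 1 + a + b, 1 + a + b + c]"
      by (subst x_eq) (simp add: 1 del: add_bit_eq_xor)
    moreover have "ones x + triangle_weight (replicate k 0 @ [a, b, c]) + 3 \<le> 2 * (k + 4)"
      using light unfolding triangle_weight_rec[of x] d x .
    ultimately have "k + ones [1, 1 + a, 1 + a + b, 1 + a + b + c]
        + triangle_weight (replicate k 0 @ [a, b, c]) + 3 \<le> 2 * (k + 4)"
      by metis
    then have "a = 0 \<and> b = 0 \<and> c = 0" using ks(2) k unfolding ks(1) triangle_weight_tail
      by (elim disjE; cases a; cases b; cases c; simp add: ones_code triangle_weight_tail_small)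
    then have "x = replicate (k + 4) 1"
      unfolding replicate_add by (subst x_eq) (simp add: 1 numeral_eq_Suc)
    then show ?thesis ..
  qed
qed

lemma thin_of_derivative_tail:
  assumes "length x = k + 4" "12 \<le> k" "derivative x = replicate k 0 @ [a, b, c]"
    and "triangle_weight x + 3 \<le> 2 * length x"
  shows "thin x"
  using eq_of_derivative_tail[OF assms] thin_tail thin_replicate by metis

text \<open>Mirror image of the tail case, obtained by passing to \<open>rev x\<close>.\<close>

lemma thin_of_derivative_head:
  assumes "length x = k + 4" "12 \<le> k" "derivative x = [a, b, c] @ replicate k 0"
    and "triangle_weight x + 3 \<le> 2 * length x"
  shows "thin x"
proof -
  have "(\<exists>a b c. rev x = replicate (k + 1) 0 @ [a, b, c]) \<or> rev x = replicate (k + 4) 1"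
    by (rule eq_of_derivative_tail[where a = c and b = b and c = a])
      (use assms in \<open>simp_all add: derivative_rev triangle_weight_rev\<close>)
  then have "(\<exists>a b c. x = [c, b, a] @ replicate (k + 1) 0) \<or> x = replicate (k + 4) 1"
    unfolding rev_swap by (simp add: replicate_append_same)
  then show ?thesis using thin_head thin_replicate by metis
qed

text \<open>An antiderivative again has period 4. If \<open>a = c\<close>, its third derivative
  vanishes. Otherwise the four rows from \<open>x\<close> down to the third derivative have
  densities of ones at least 1/4, then 1/2, 1/2 and 1, in total 9/4, too much for
  \<open>n \<ge> 16\<close>.\<close>

lemma thin_of_derivative_periodic:
  assumes x: "length x = Suc n" and n: "16 \<le> n"
    and d: "derivative x = periodic_prefix [a, b, c, a + b + c] n"
    and light: "triangle_weight x + 3 \<le> 2 * length x"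
  shows "thin x"
proof -
  define e where "e = hd x"
  let ?y = "periodic_prefix [e, e + a, e + a + b, e + a + b + c] (Suc n)"
  \<comment> \<open>The letters \<open>a\<close>, \<open>b\<close>, \<open>c\<close>,
    \<open>a + b + c\<close> sum to zero, so the partial sums close up after four steps.\<close>
  have cyc: "[e + (e + a), e + a + (e + a + b), e + a + b + (e + a + b + c), e + a + b + c + e] =
      [a, b, c, a + b + c]"
    by (cases a; cases b; cases c; cases e) simp_all
  have x_ne: "x \<noteq> []" using x by auto
  have y_ne: "?y \<noteq> []" by (simp add: periodic_prefix_def)
  have "derivative ?y = derivative x"
    unfolding d derivative_periodic_prefix cyc by simp
  moreover have "hd ?y = hd x"
    by (simp add: periodic_prefix_def e_def upt_conv_Cons del: upt_Suc)
  ultimately have x_eq: "x = ?y"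
    using integrate_hd_derivative[of x] integrate_hd_derivative[of ?y] x
    using x_ne y_ne by simp
  show ?thesis
  proof (cases "a = c")
    case True
    have "e + (e + a) + (e + a + b) = e + a + b + c"
      unfolding True by (cases e; cases b; cases c) simp_all
    then show ?thesis unfolding x_eq by (metis thin_periodic)
  next
    case False
    \<comment> \<open>Dividing the shortest of the row lengths \<open>n + 1\<close>,
      \<open>n\<close>, \<open>n - 1\<close>, \<open>n - 2\<close> by 4 makes the others
      \<open>4 * q\<close> plus at most 6.\<close>
    obtain q s where "n - 2 = 4 * q + s" and s: "s = 0 \<or> s = 1 \<or> s = 2 \<or> s = 3"
      by (rule nat_div4E)
    then have ks: "n = 4 * q + s + 2" using n by simp
    have n_eq: "Suc n = 4 * q + (s + 3)" "n = 4 * q + (s + 2)" "n - 1 = 4 * q + (s + 1)" "n - 2 = 4 * q + s"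
      using ks by simp_all
    have "triangle_weight x = ones (periodic_prefix [e, e + a, e + a + b, e + a + b + c] (Suc n))
        + (ones (periodic_prefix [a, b, c, a + b + c] n)
        + ones (periodic_prefix [a + b, b + c, a + b, b + c] (n - 1))
        + ones (periodic_prefix [a + c, a + c, a + c, a + c] (n - 2)))"
      unfolding triangle_weight_rec[of x] d triangle_weight_periodic by (simp only: x_eq)
    with False s n light[unfolded x n_eq(1)] show ?thesis
      unfolding n_eq(4) unfolding n_eq(3) unfolding n_eq(1) unfolding n_eq(2) \<comment> \<open>\<open>n\<close> last, as it occurs in the others\<close>
      by (elim disjE; cases a; cases b; cases c; cases e;
          simp add: ones_periodic_prefix_small ones_code)
  qed
qed
text \<open>Lengths 16 to 19 start the induction, which may go back four rows; 10, 12 and 14 are the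
  even lengths below its range. For 10 and 14 the bound is \<open>2 * n - 4\<close>, the claimed w_3
  for \<open>n mod 4 = 2\<close>.\<close>

lemma light_thin:
  "list_all (\<lambda>x. triangle_weight x + 4 \<le> 20 \<longrightarrow> thin x) (light_words 10)"
  "list_all thin (light_words 12)"
  "list_all (\<lambda>x. triangle_weight x + 4 \<le> 28 \<longrightarrow> thin x) (light_words 14)"
  "list_all thin (light_words 16)"
  "list_all thin (light_words 17)"
  "list_all thin (light_words 18)"
  "list_all thin (light_words 19)"
  by code_simp+

subsection \<open>Light words are thin\<close>

lemma derivative_append: "derivative (x @ a # y) = derivative (x @ [a]) @ derivative (a # y)"
proof (induction x)
  case (Cons b x)
  then show ?case by (cases x) (simp_all add: derivative_code del: add_bit_eq_xor)
qed (simp add: derivative_code)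

lemma derivative_Cons_replicate_0: "derivative (0 # replicate j 0) = replicate j 0"
  by (induction j) (simp_all add: derivative_code)

lemma derivative_padded:
  "derivative (replicate (Suc i) 0 @ x @ replicate (Suc j) 0) =
   replicate i 0 @ derivative (0 # x @ [0]) @ replicate j 0"
proof -
  have "derivative (0 # x @ replicate (Suc j) 0) = derivative (0 # x @ [0]) @ replicate j 0"
    using derivative_append[of "0 # x" 0 "replicate j 0"] by (simp add: derivative_Cons_replicate_0)
  then show ?thesis by (simp only: derivative_replicate_append)
qed

lemma triangle_weight_padded:
  "triangle_weight (replicate (Suc i) 0 @ x @ replicate (Suc j) 0) =
   ones x + triangle_weight (replicate i 0 @ derivative (0 # x @ [0]) @ replicate j 0)"
  by (subst triangle_weight_rec) (simp only: derivative_padded ones_append ones_replicate add_0 add_0_right)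

lemma sparse_wordsD:
  "x \<in> set (sparse_words n) \<Longrightarrow>
   x = replicate n 0 \<or> (\<exists>i j. n = i + Suc j \<and> x = replicate i 0 @ 1 # replicate j 0)"
proof (induction n arbitrary: x)
  case (Suc n)
  from Suc.prems consider "x = replicate 0 0 @ 1 # replicate n 0" | y where "y \<in> set (sparse_words n)" "x = 0 # y"
    by auto
  then show ?case
  proof cases
    case 1
    then show ?thesis by (metis add_0)
  next
    case 2
    with Suc.IH[of y] show ?thesis
      by (metis add_Suc append_Cons replicate_Suc)
  qed
qed simp

text \<open>Pointwise consequences, weaker than the three forms but refutable by looking at one or
  two letters.\<close>

lemma thinD:
  assumes "thin x" "3 \<le> length x"
  shows "(\<forall>p < length x - 3. x ! p = 0) \<or> (\<forall>p < length x. 3 \<le> p \<longrightarrow> x ! p = 0)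
    \<or> (\<forall>p. p + 4 < length x \<longrightarrow> x ! (p + 4) = x ! p)"
proof -
  from assms(1) consider a b c where "x = replicate (length x - 3) 0 @ [a, b, c]"
    | a b c where "x = [a, b, c] @ replicate (length x - 3) 0"
    | a b c where "x = periodic_prefix [a, b, c, a + b + c] (length x)"
    unfolding thin_def by blast
  then show ?thesis
  proof cases
    case 1
    then have "x ! p = 0" if "p < length x - 3" for p
      using that by (metis length_replicate nth_append nth_replicate)
    then show ?thesis by blast
  next
    case 2
    have "x ! p = 0" if "p < length x" "3 \<le> p" for p
      by (subst 2, subst nth_append) (use that in simp)
    then show ?thesis by blast
  next
    case 3
    have "x ! (p + 4) = x ! p" if "p + 4 < length x" for p
      by (subst (1 2) 3) (use that in \<open>simp add: periodic_prefix_def\<close>)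
    then show ?thesis by blast
  qed
qed

text \<open>The derivative has ones exactly at positions \<open>i - 1\<close> and
  \<open>i + 3\<close>, where these exist. As \<open>i + j\<close> is large, one side has enough
  zeros to contradict each of the three forms.\<close>

lemma not_thin_derivative_1111:
  assumes "13 \<le> i + j"
  shows "\<not> thin (derivative (replicate i 0 @ [1, 1, 1, 1] @ replicate j 0))"
proof
  let ?y = "replicate i 0 @ [1, 1, 1, 1] @ replicate j (0::bit)"
  let ?z = "derivative ?y"
  assume "thin ?z"
  have y: "?y ! p = (if i \<le> p \<and> p < i + 4 then 1 else 0)" if "p < i + j + 4" for p
    using that by (auto simp: nth_append nth_Cons' numeral_eq_Suc)
  have z: "?z ! p = (if p + 1 = i \<or> p = i + 3 then 1 else 0)" if "p < i + j + 3" for p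
  proof -
    have "?z ! p = ?y ! p + ?y ! (p + 1)"
      by (rule nth_derivative) (use that in simp)
    then show ?thesis using y[of p] y[of "p + 1"] that by auto
  qed
  have len: "length ?z = i + j + 3" by simp
  from thinD[OF \<open>thin ?z\<close>] consider
      "\<And>p. p < i + j \<Longrightarrow> ?z ! p = 0"
    | "\<And>p. p < i + j + 3 \<Longrightarrow> 3 \<le> p \<Longrightarrow> ?z ! p = 0"
    | "\<And>p. p + 4 < i + j + 3 \<Longrightarrow> ?z ! (p + 4) = ?z ! p"
    unfolding len by force
  then show False
  proof cases
    case 1
    show False
    proof (cases "3 < j")
      case True
      then show False using 1[of "i + 3"] z[of "i + 3"] by simp
    next
      case False
      then have "i - 1 < i + j" "i - 1 + 1 = i" using assms by linarith+
      then show False using 1[of "i - 1"] z[of "i - 1"] by simp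
    qed
  next
    case 2
    show False
    proof (cases "0 < j")
      case True
      then show False using 2[of "i + 3"] z[of "i + 3"] by simp
    next
      case False
      then have "i - 1 < i + j + 3" "3 \<le> i - 1" "i - 1 + 1 = i" using assms by linarith+
      then show False using 2[of "i - 1"] z[of "i - 1"] by simp
    qed
  next
    case 3
    \<comment> \<open>Two ones at distance 4 agree with period 4, so one of them is compared with
      the zero four places further out.\<close>
    show False
    proof (cases "4 < j")
      case True
      then show False using 3[of "i + 3"] z[of "i + 3"] z[of "i + 7"] by (simp add: add.assoc)
    next
      case False
      then have i: "i = i - 5 + 5" using assms by linarith
      then have "?z ! (i - 5 + 4) = ?z ! (i - 5)" by (intro 3) linarith
      moreover have "?z ! (i - 5 + 4) = 1" using z[of "i - 5 + 4"] i by simp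
      moreover have "?z ! (i - 5) = 0" using z[of "i - 5"] i by simp
      ultimately show False by simp
    qed
  qed
qed

text \<open>Near an end the word lies in a family directly. Otherwise the top four rows carry 9 ones
  while the bound drops only by 8, so the fourth derivative would be light, hence thin, which it is
  not.\<close>

lemma thin_unit:
  assumes len: "20 \<le> i + Suc j"
    and light: "triangle_weight (replicate i 0 @ 1 # replicate j 0) + 3 \<le> 2 * (i + Suc j)"
    and smaller: "\<And>y. length y + 4 = i + Suc j \<Longrightarrow> triangle_weight y + 3 \<le> 2 * length y \<Longrightarrow> thin y"
  shows "thin (replicate i 0 @ 1 # replicate j 0)"
proof -
  consider "i \<le> 2" | "j \<le> 2" | "3 \<le> i" "3 \<le> j" by linarith
  then show ?thesis
  proof cases
    case 1
    then have "i = 0 \<or> i = 1 \<or> i = 2" by linarith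
    moreover define l where "l = j - 2"
    then have "j = Suc (Suc l)" using len 1 by linarith
    ultimately show ?thesis
      using thin_head[of 1 0 0 l] thin_head[of 0 1 0 "Suc l"] thin_head[of 0 0 1 "Suc (Suc l)"]
      by (auto simp: numeral_2_eq_2)
  next
    case 2
    then have "j = 0 \<or> j = 1 \<or> j = 2" by linarith
    moreover define l where "l = i - 2"
    then have "i = l + 2" using len 2 by linarith
    ultimately show ?thesis
      using thin_tail[of l 0 0 1] thin_tail[of "l + 1" 0 1 0] thin_tail[of "l + 2" 1 0 0]
      by (auto simp: numeral_2_eq_2 replicate_app_Cons_same)
  next
    case 3
    define k l where "k = i - 3" and "l = j - 3"
    with 3 have kl: "i = Suc (Suc (Suc k))" "j = Suc (Suc (Suc l))" by linarith+
    let ?y = "derivative (replicate k 0 @ [1, 1, 1, 1] @ replicate l 0)"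
    have "triangle_weight (replicate i 0 @ [1] @ replicate j 0) = 9 + triangle_weight ?y"
    proof -
      have rows: "derivative (0 # [1] @ [0]) = [1, 1]" "derivative (0 # [1, 1] @ [0]) = [1, 0, 1]"
        "derivative (0 # [1, 0, 1] @ [0]) = [1, 1, 1, 1]"
        by (simp_all add: derivative_code)
      show ?thesis
        unfolding kl triangle_weight_padded rows
        by (subst triangle_weight_rec) (simp add: ones_code)
    qed
    \<comment> \<open>From at least 19 zeros, three are lost on either side, which leaves the
      required 13.\<close>
    moreover have "\<not> thin ?y" by (rule not_thin_derivative_1111) (use len kl in simp)
    ultimately show ?thesis using light smaller[of ?y] kl by simp
  qed
qed

text \<open>From length 20 on, removing one row, or four rows below a single 1, leaves length at
  least 16, where the induction hypothesis applies.\<close>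

theorem light_imp_thin:
  "16 \<le> length x \<Longrightarrow> triangle_weight x + 3 \<le> 2 * length x \<Longrightarrow> thin x"
proof (induction "length x" arbitrary: x rule: less_induct)
  case less
  show ?case
  proof (cases "length x < 20")
    case True
    then have "length x = 16 \<or> length x = 17 \<or> length x = 18 \<or> length x = 19"
      using less.prems(1) by linarith
    then show ?thesis
      using light_wordsI[OF less.prems(2)] light_thin(4-7) by (auto simp: list_all_iff)
  next
    case False
    show ?thesis
    proof (cases "ones x \<le> 1")
      case True
      then consider "x = replicate (length x) 0"
        | i j where "length x = i + Suc j" "x = replicate i 0 @ 1 # replicate j 0"
        using sparse_wordsD sparse_wordsI by blast
      then show ?thesis
      proof cases
        case 1
        then show ?thesis using thin_replicate by metis
      next
        case (2 i j)
        have "thin y" if "length y + 4 = length x" "triangle_weight y + 3 \<le> 2 * length y" for y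
          by (rule less.hyps) (use that False in auto)
        then show ?thesis
          using thin_unit[of i j] False less.prems(2) 2 by simp
      qed
    next
      case ones: False
      define k where "k = length x - 4"
      with False have k: "length x = k + 4" "16 \<le> k" by linarith+
      have "thin (derivative x)"
        by (rule less.hyps)
          (use ones less.prems(2) k triangle_weight_rec[of x] in auto)
      moreover have "length (derivative x) = k + 3" using k by simp
      ultimately consider a b c where "derivative x = replicate k 0 @ [a, b, c]"
        | a b c where "derivative x = [a, b, c] @ replicate k 0"
        | a b c where "derivative x = periodic_prefix [a, b, c, a + b + c] (k + 3)"
        unfolding thin_def by force
      then show ?thesis
      proof cases
        case 1
        then show ?thesis using thin_of_derivative_tail k less.prems(2) by simp
      next
        case 2
        then show ?thesis using thin_of_derivative_head k less.prems(2) by simp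
      next
        case 3
        then show ?thesis using thin_of_derivative_periodic[of x "k + 3"] k less.prems(2) by simp
      qed
    qed
  qed
qed

text \<open>The bound is the claimed w_3, so this covers every word in the first four weight
  classes.\<close>

lemma light_imp_thin_even:
  assumes "10 \<le> length x" "even (length x)"
    and "triangle_weight x + (if length x mod 4 = 0 then 3 else 4) \<le> 2 * length x"
  shows "thin x"
proof (cases "length x < 16")
  case True
  then have "length x = 10 \<or> length x = 12 \<or> length x = 14"
    using assms(1,2) by presburger
  moreover have "x \<in> set (light_words (length x))"
    by (rule light_wordsI) (use assms(3) in \<open>simp split: if_splits\<close>)
  ultimately show ?thesis
    using assms(3) light_thin(1-3) by (auto simp: list_all_iff)
next
  case False
  then show ?thesis using assms(3) light_imp_thin by (simp split: if_splits)
qed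

subsection \<open>The fourth smallest weight\<close>

lemma nth_weight_3:
  assumes "v0 < v1" "v1 < v2" "v2 < v3" "{v0, v1, v2, v3} \<subseteq> triangle_weights n"
    and "\<And>w. w \<in> triangle_weights n \<Longrightarrow> w \<le> v3 \<Longrightarrow> w \<in> {v0, v1, v2, v3}"
  shows "3 < card (triangle_weights n)" and "nth_weight n 3 = v3"
proof -
  \<comment> \<open>\<open>sorted_list_of_set\<close> enumerates only finite sets, so finiteness of
    the set of weights comes first.\<close>
  have "set x \<subseteq> {0, 1}" for x :: "bit list"
    using bit_not_one_iff by blast
  then have "finite {x :: bit list. length x = n}"
    using finite_lists_length_eq[of "{0, 1 :: bit}" n] by simp
  then have fin: "finite (triangle_weights n)"
    by (simp add: triangle_weights_def binary_words_def)
  define R where "R = {w \<in> triangle_weights n. v3 < w}"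
  have R: "finite R" "\<And>w. w \<in> R \<Longrightarrow> v3 < w" using fin by (auto simp: R_def)
  have split: "triangle_weights n = {v0, v1, v2, v3} \<union> R"
    using assms(4,5) unfolding R_def by (auto simp: not_le[symmetric] simp del: not_le)
  have "card {v0, v1, v2, v3} = 4" using assms(1-3) by simp
  then show "3 < card (triangle_weights n)"
    using card_mono[OF fin assms(4)] by simp
  define xs where "xs = [v0, v1, v2, v3] @ sorted_list_of_set R"
  have "v0 < w \<and> v1 < w \<and> v2 < w \<and> v3 < w" if "w \<in> R" for w
    using R(2)[OF that] assms(1-3) by simp
  then have "sorted xs" "distinct xs"
    using assms(1-3) R(1) by (fastforce simp: xs_def sorted_append)+
  moreover have "set xs = triangle_weights n"
    using R(1) by (auto simp: xs_def split)
  ultimately have "sorted_list_of_set (triangle_weights n) = xs"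
    using sorted_list_of_set.idem_if_sorted_distinct by metis
  then show "nth_weight n 3 = v3" by (simp add: nth_weight_def xs_def)
qed

section \<open>Thin words of weight at most w_3\<close>

lemma thin_cases:
  assumes "thin x"
  obtains a b c where "x = replicate (length x - 3) 0 @ [a, b, c]"
    | a b c where "x = [a, b, c] @ replicate (length x - 3) 0"
    | a b c where "x = periodic_prefix [a, b, c, a + b + c] (length x)"
  using assms unfolding thin_def by blast

lemma triangle_weight_head:
  "triangle_weight ([a, b, c] @ replicate k 0) = triangle_weight (replicate k 0 @ [c, b, a])"
  using triangle_weight_rev[of "[a, b, c] @ replicate k 0"] by simp

text \<open>The values are 0, n, 3n/2 - 1 and 2n - 3. In each family exactly four words have weight
  growing like \<open>8 * q\<close>: two weigh \<open>8 * q + 5\<close> and two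
  \<open>8 * q + 6\<close>. This gives six words.\<close>

lemma thin_weight_0_mod_4:
  assumes n: "n = 4 * q + 4" and q: "2 \<le> q" and x: "length x = n" "thin x"
    and light: "triangle_weight x \<le> 8 * q + 5"
  shows "triangle_weight x \<in> {0, 4 * q + 4, 6 * q + 5, 8 * q + 5}"
    and "triangle_weight x = 8 * q + 5 \<Longrightarrow>
      x \<in> {periodic_prefix [0, 0, 1, 1] n, [1, 0, 1] @ replicate (n - 3) 0, replicate (n - 3) 0 @ [1, 0, 0],
           periodic_prefix [1, 1, 0, 0] n, [0, 0, 1] @ replicate (n - 3) 0, replicate (n - 3) 0 @ [1, 0, 1]}"
proof -
  have n_eq: "n - 3 = 4 * q + 1" "n = 4 * q + 4" "n - 1 = 4 * q + 3" "n - 2 = 4 * q + 2"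
    using n by simp_all
  from x(2) have "triangle_weight x \<in> {0, 4 * q + 4, 6 * q + 5, 8 * q + 5} \<and> (triangle_weight x = 8 * q + 5 \<longrightarrow>
      x \<in> {periodic_prefix [0, 0, 1, 1] n, [1, 0, 1] @ replicate (n - 3) 0, replicate (n - 3) 0 @ [1, 0, 0],
           periodic_prefix [1, 1, 0, 0] n, [0, 0, 1] @ replicate (n - 3) 0, replicate (n - 3) 0 @ [1, 0, 1]})"
  proof (cases rule: thin_cases)
    case (1 a b c)
    then have "triangle_weight x = triangle_weight (replicate (4 * q + 1) 0 @ [a, b, c])"
      unfolding x(1) n_eq(1) by metis
    with 1 light q show ?thesis unfolding x(1) triangle_weight_tail
      by (cases a; cases b; cases c; simp add: triangle_weight_tail_small ones_code)
  next
    case (2 a b c)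
    then have "triangle_weight x = triangle_weight (replicate (4 * q + 1) 0 @ [c, b, a])"
      unfolding x(1) n_eq(1) by (metis triangle_weight_head)
    with 2 light q show ?thesis unfolding x(1) triangle_weight_tail
      by (cases a; cases b; cases c; simp add: triangle_weight_tail_small ones_code)
  next
    case (3 a b c)
    then have "triangle_weight x = ones (periodic_prefix [a, b, c, a + b + c] (4 * q + 4))
        + ones (periodic_prefix [a + b, b + c, a + b, b + c] (4 * q + 3))
        + ones (periodic_prefix [a + c, a + c, a + c, a + c] (4 * q + 2))"
      unfolding x(1) by (metis triangle_weight_periodic n_eq(2-4))
    with 3 light q show ?thesis unfolding x(1)
      by (cases a; cases b; cases c; simp add: ones_periodic_prefix_small ones_code)
  qed
  then show "triangle_weight x \<in> {0, 4 * q + 4, 6 * q + 5, 8 * q + 5}"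
    and "triangle_weight x = 8 * q + 5 \<Longrightarrow>
      x \<in> {periodic_prefix [0, 0, 1, 1] n, [1, 0, 1] @ replicate (n - 3) 0, replicate (n - 3) 0 @ [1, 0, 0],
           periodic_prefix [1, 1, 0, 0] n, [0, 0, 1] @ replicate (n - 3) 0, replicate (n - 3) 0 @ [1, 0, 1]}"
    by blast+
qed

text \<open>The values are 0, n, 3n/2 - 1 and 2n - 4. For this residue, of the four words per family
  with growth \<open>8 * q\<close>, one weighs \<open>8 * q + 8\<close> and three weigh
  \<open>8 * q + 10\<close>, which leaves three words.\<close>

lemma thin_weight_2_mod_4:
  assumes n: "n = 4 * q + 6" and q: "1 \<le> q" and x: "length x = n" "thin x"
    and light: "triangle_weight x \<le> 8 * q + 8"
  shows "triangle_weight x \<in> {0, 4 * q + 6, 6 * q + 8, 8 * q + 8}"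
    and "triangle_weight x = 8 * q + 8 \<Longrightarrow>
      x \<in> {periodic_prefix [0, 0, 1, 1] n, replicate (n - 3) 0 @ [1, 0, 0], [0, 0, 1] @ replicate (n - 3) 0}"
proof -
  have n_eq: "n - 3 = 4 * q + 3" "n = 4 * q + 6" "n - 1 = 4 * q + 5" "n - 2 = 4 * q + 4"
    using n by simp_all
  from x(2) have "triangle_weight x \<in> {0, 4 * q + 6, 6 * q + 8, 8 * q + 8} \<and> (triangle_weight x = 8 * q + 8 \<longrightarrow>
      x \<in> {periodic_prefix [0, 0, 1, 1] n, replicate (n - 3) 0 @ [1, 0, 0], [0, 0, 1] @ replicate (n - 3) 0})"
  proof (cases rule: thin_cases)
    case (1 a b c)
    then have "triangle_weight x = triangle_weight (replicate (4 * q + 3) 0 @ [a, b, c])"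
      unfolding x(1) n_eq(1) by metis
    with 1 light q show ?thesis unfolding x(1) triangle_weight_tail
      by (cases a; cases b; cases c; simp add: triangle_weight_tail_small ones_code)
  next
    case (2 a b c)
    then have "triangle_weight x = triangle_weight (replicate (4 * q + 3) 0 @ [c, b, a])"
      unfolding x(1) n_eq(1) by (metis triangle_weight_head)
    with 2 light q show ?thesis unfolding x(1) triangle_weight_tail
      by (cases a; cases b; cases c; simp add: triangle_weight_tail_small ones_code)
  next
    case (3 a b c)
    then have "triangle_weight x = ones (periodic_prefix [a, b, c, a + b + c] (4 * q + 6))
        + ones (periodic_prefix [a + b, b + c, a + b, b + c] (4 * q + 5))
        + ones (periodic_prefix [a + c, a + c, a + c, a + c] (4 * q + 4))"
      unfolding x(1) by (metis triangle_weight_periodic n_eq(2-4))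
    with 3 light q show ?thesis unfolding x(1)
      by (cases a; cases b; cases c; simp add: ones_periodic_prefix_small ones_code)
  qed
  then show "triangle_weight x \<in> {0, 4 * q + 6, 6 * q + 8, 8 * q + 8}"
    and "triangle_weight x = 8 * q + 8 \<Longrightarrow>
      x \<in> {periodic_prefix [0, 0, 1, 1] n, replicate (n - 3) 0 @ [1, 0, 0], [0, 0, 1] @ replicate (n - 3) 0}"
    by blast+
qed

theorem theorem6p9:
  fixes n :: nat and c1 c2 c3 c4 c5 c6 :: "bit list"
  assumes "n \<ge> 10" and "even n"
    and "c1 = periodic_prefix [0, 0, 1, 1] n"
    and "c2 = [1, 0, 1] @ periodic_prefix [0] (n - 3)"
    and "c3 = periodic_prefix [0] (n - 3) @ [1, 0, 0]"
    and "c4 = periodic_prefix [1, 1, 0, 0] n"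
    and "c5 = [0, 0, 1] @ periodic_prefix [0] (n - 3)"
    and "c6 = periodic_prefix [0] (n - 3) @ [1, 0, 1]"
  shows "3 < card (triangle_weights n)
    \<and> (n mod 4 = 0 \<longrightarrow>
        nth_weight n 3 = 2 * n - 3 \<and> weight_class n 3 = {c1, c2, c3, c4, c5, c6})
    \<and> (n mod 4 = 2 \<longrightarrow>
        nth_weight n 3 = 2 * n - 4 \<and> weight_class n 3 = {c1, c3, c5})"
proof -
  note c = assms(3-8)[unfolded periodic_prefix_singleton]
  have periodic: "triangle_weight (periodic_prefix [0, 0, 1, 1] m) = ones (periodic_prefix [0, 0, 1, 1] m)
      + ones (periodic_prefix [0, 1, 0, 1] (m - 1)) + ones (periodic_prefix [1, 1, 1, 1] (m - 2))"
    "triangle_weight (periodic_prefix [1, 1, 0, 0] m) = ones (periodic_prefix [1, 1, 0, 0] m)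
      + ones (periodic_prefix [0, 1, 0, 1] (m - 1)) + ones (periodic_prefix [1, 1, 1, 1] (m - 2))" for m
    using triangle_weight_periodic[of 0 0 1 m] triangle_weight_periodic[of 1 1 0 m] by simp_all
  have in_weights: "w \<in> triangle_weights n" if "triangle_weight x = w" "length x = n" for w x
    using that by (auto simp: triangle_weights_def binary_words_def)
  \<comment> \<open>The offsets 4 and 6 keep \<open>n - 1\<close>, \<open>n - 2\<close> and
    \<open>n - 3\<close> of the form \<open>4 * q + s\<close> with natural \<open>s\<close>.\<close>
  consider q where "n = 4 * q + 4" "2 \<le> q" | q where "n = 4 * q + 6" "1 \<le> q"
  proof (cases "n mod 4 = 0")
    case True
    then have "n = 4 * (n div 4 - 1) + 4" "2 \<le> n div 4 - 1" using assms(1) by presburger+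
    then show thesis by (rule that(1))
  next
    case False
    then have "n = 4 * (n div 4 - 1) + 6" "1 \<le> n div 4 - 1" using assms(1,2) by presburger+
    then show thesis by (rule that(2))
  qed
  then show ?thesis
  proof cases
    case (1 q)
    have n_eq: "n - 3 = 4 * q + 1" "n - 1 = 4 * q + 3" "n - 2 = 4 * q + 2" using 1 by simp_all
    have thin: "thin x" if "length x = n" "triangle_weight x \<le> 8 * q + 5" for x
      by (rule light_imp_thin_even) (use that 1 in auto)
    have len: "length x = n" if "x \<in> {c1, c2, c3, c4, c5, c6}" for x
      using that 1 by (auto simp: c)
    have w3: "triangle_weight x = 8 * q + 5" if "x \<in> {c1, c2, c3, c4, c5, c6}" for x
      using that unfolding c insert_iff empty_iff
      by (elim disjE FalseE; simp only: periodic triangle_weight_head triangle_weight_tail n_eq;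
          simp add: 1(1) triangle_weight_tail_small ones_periodic_prefix_small ones_code)
    \<comment> \<open>Witnesses for w_1 = n and w_2 = 3n/2 - 1.\<close>
    have ends: "triangle_weight (replicate (n - 3) 0 @ [0, 0, 1]) = 4 * q + 4"
      "triangle_weight (replicate (n - 3) 0 @ [0, 1, 0]) = 6 * q + 5"
      unfolding n_eq triangle_weight_tail by (simp_all add: triangle_weight_tail_small ones_code)
    have "0 \<in> triangle_weights n" by (rule in_weights[OF triangle_weight_replicate_0[of n]]) simp_all
    moreover have "4 * q + 4 \<in> triangle_weights n" by (rule in_weights[OF ends(1)]) (use 1 in simp)
    moreover have "6 * q + 5 \<in> triangle_weights n" by (rule in_weights[OF ends(2)]) (use 1 in simp)
    moreover have "8 * q + 5 \<in> triangle_weights n" by (rule in_weights[OF w3[of c1] len[of c1]]) simp_all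
    ultimately have "{0, 4 * q + 4, 6 * q + 5, 8 * q + 5} \<subseteq> triangle_weights n" by blast
    moreover have "w \<in> {0, 4 * q + 4, 6 * q + 5, 8 * q + 5}"
      if "w \<in> triangle_weights n" "w \<le> 8 * q + 5" for w
    proof -
      from that(1) obtain x where x: "length x = n" "w = triangle_weight x"
        by (auto simp: triangle_weights_def binary_words_def)
      then show ?thesis using thin_weight_0_mod_4(1)[OF 1 x(1) thin] that(2) by metis
    qed
    moreover have "0 < 4 * q + 4" "4 * q + 4 < 6 * q + 5" "6 * q + 5 < 8 * q + 5" using 1 by simp_all
    ultimately have card: "3 < card (triangle_weights n)" and nth: "nth_weight n 3 = 8 * q + 5"
      using nth_weight_3 by metis+
    have "x \<in> {c1, c2, c3, c4, c5, c6}" if "length x = n" "triangle_weight x = 8 * q + 5" for x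
      using thin_weight_0_mod_4(2)[OF 1 that(1) thin[OF that(1)]] that(2) unfolding c by simp
    then have "weight_class n 3 = {c1, c2, c3, c4, c5, c6}"
      using len w3 unfolding weight_class_def binary_words_def nth by blast
    then show ?thesis using card nth 1 by simp
  next
    case (2 q)
    have n_eq: "n - 3 = 4 * q + 3" "n - 1 = 4 * q + 5" "n - 2 = 4 * q + 4" using 2 by simp_all
    have mod4: "n mod 4 = 2" using 2(1) by presburger
    \<comment> \<open>Here \<open>8 * q + 8\<close> is \<open>2 * n - 4\<close>, and
      \<open>mod4\<close> selects the matching bound in \<open>light_imp_thin_even\<close>.\<close>
    have thin: "thin x" if "length x = n" "triangle_weight x \<le> 8 * q + 8" for x
      by (rule light_imp_thin_even) (use that 2 mod4 in auto)
    have len: "length x = n" if "x \<in> {c1, c3, c5}" for x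
      using that 2 by (auto simp: c)
    have w3: "triangle_weight x = 8 * q + 8" if "x \<in> {c1, c3, c5}" for x
      using that unfolding c insert_iff empty_iff
      by (elim disjE FalseE; simp only: periodic triangle_weight_head triangle_weight_tail n_eq;
          simp add: 2(1) triangle_weight_tail_small ones_periodic_prefix_small ones_code)
    have ends: "triangle_weight (replicate (n - 3) 0 @ [0, 0, 1]) = 4 * q + 6"
      "triangle_weight (replicate (n - 3) 0 @ [0, 1, 0]) = 6 * q + 8"
      unfolding n_eq triangle_weight_tail by (simp_all add: triangle_weight_tail_small ones_code)
    have "0 \<in> triangle_weights n" by (rule in_weights[OF triangle_weight_replicate_0[of n]]) simp_all
    moreover have "4 * q + 6 \<in> triangle_weights n" by (rule in_weights[OF ends(1)]) (use 2 in simp)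
    moreover have "6 * q + 8 \<in> triangle_weights n" by (rule in_weights[OF ends(2)]) (use 2 in simp)
    moreover have "8 * q + 8 \<in> triangle_weights n" by (rule in_weights[OF w3[of c1] len[of c1]]) simp_all
    ultimately have "{0, 4 * q + 6, 6 * q + 8, 8 * q + 8} \<subseteq> triangle_weights n" by blast
    moreover have "w \<in> {0, 4 * q + 6, 6 * q + 8, 8 * q + 8}"
      if "w \<in> triangle_weights n" "w \<le> 8 * q + 8" for w
    proof -
      from that(1) obtain x where x: "length x = n" "w = triangle_weight x"
        by (auto simp: triangle_weights_def binary_words_def)
      then show ?thesis using thin_weight_2_mod_4(1)[OF 2 x(1) thin] that(2) by metis
    qed
    moreover have "0 < 4 * q + 6" "4 * q + 6 < 6 * q + 8" "6 * q + 8 < 8 * q + 8" using 2 by simp_all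
    ultimately have card: "3 < card (triangle_weights n)" and nth: "nth_weight n 3 = 8 * q + 8"
      using nth_weight_3 by metis+
    have "x \<in> {c1, c3, c5}" if "length x = n" "triangle_weight x = 8 * q + 8" for x
      using thin_weight_2_mod_4(2)[OF 2 that(1) thin[OF that(1)]] that(2) unfolding c by simp
    then have "weight_class n 3 = {c1, c3, c5}"
      using len w3 unfolding weight_class_def binary_words_def nth by blast
    then show ?thesis using card nth 2(1) mod4 by simp
  qed
qed

end
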